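(* For all integers $n\geq k>d\geq 1$, \[T(n,k,d)=t(n-k+d,d)+T(n,k-d+1,1),\] and for all integers $n\geq k\geq 1$ and $d\geq 1$ with $k\leq d$, \[T(n,k,d)=t(n,k).\]
   Context: A box in $\mathbb{R}^d$ is an axis-parallel box, i.e. a Cartesian product $[a_1,b_1]\times\dots\times[a_d,b_d]$ of compact intervals (degenerate intervals $a_i=b_i$ allowed). A family of $n$ boxes is a list of $n$ boxes (repetitions allowed); an intersecting pair is an unordered pair of distinct members of the list with nonempty intersection. For integers $n\geq k\geq 1$ and $d\geq 1$, $T(n,k,d)$ denotes the maximum number of intersecting pairs in a family of $n$ boxes in $\mathbb{R}^d$ with the property that no $k+1$ members of the family have a point in common. For integers $n\geq m\geq 1$, $t(n,m)$ denotes the number of edges of the Turán graph $\mathcal{T}(n,m)$, the complete $m$-partite graph on $n$ vertices whose $m$ vertex classes have sizes differing by at most one; $t(n,1)=0$. *)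

theory Defs
  imports Complex_Main "HOL-Library.FuncSet"
begin

text \<open>
  Since the dimension varies inside the statement, points of \<open>\<real>\<^sup>d\<close> are extensional functions
  on the coordinate set \<open>{..<d}\<close>.
\<close>

definition is_box :: "nat \<Rightarrow> (nat \<Rightarrow> real) set \<Rightarrow> bool" where
  "is_box d B \<longleftrightarrow> (\<exists>a b. (\<forall>i<d. a i \<le> b i) \<and> B = (\<Pi>\<^sub>E i\<in>{..<d}. {a i..b i}))"

definition box_family :: "nat \<Rightarrow> nat \<Rightarrow> (nat \<Rightarrow> real) set list \<Rightarrow> bool" where
  "box_family n d F \<longleftrightarrow> length F = n \<and> (\<forall>B\<in>set F. is_box d B)"

text \<open>Members of a family are identified by their positions, so repeated boxes count separately.\<close>

definition intersecting_pairs :: "'a set list \<Rightarrow> nat set set" where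
  "intersecting_pairs F =
     {{i, j} | i j. i < length F \<and> j < length F \<and> i \<noteq> j \<and> F ! i \<inter> F ! j \<noteq> {}}"

definition no_common_point :: "nat \<Rightarrow> 'a set list \<Rightarrow> bool" where
  "no_common_point r F \<longleftrightarrow>
     (\<forall>I. I \<subseteq> {..<length F} \<and> card I = r \<longrightarrow> (\<Inter>i\<in>I. F ! i) = {})"

definition pair_counts :: "nat \<Rightarrow> nat \<Rightarrow> nat \<Rightarrow> nat set" where
  "pair_counts n k d =
     {card (intersecting_pairs F) | F. box_family n d F \<and> no_common_point (k + 1) F}"

definition max_pairs :: "nat \<Rightarrow> nat \<Rightarrow> nat \<Rightarrow> nat" where
  "max_pairs n k d = Max (pair_counts n k d)"

definition complete_multipartite :: "'v set \<Rightarrow> ('v \<Rightarrow> 'c) \<Rightarrow> 'v set set" where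
  "complete_multipartite V c = {{u, v} | u v. u \<in> V \<and> v \<in> V \<and> c u \<noteq> c v}"

text \<open>
  The vertex classes of the Turan graph are realised as residue classes modulo \<open>m\<close> on \<open>{..<n}\<close>;
  \<open>turan_classes_balanced\<close> below confirms that their sizes differ by at most one.
\<close>

definition turan_graph :: "nat \<Rightarrow> nat \<Rightarrow> nat set set" where
  "turan_graph n m = complete_multipartite {..<n} (\<lambda>v. v mod m)"

definition turan_number :: "nat \<Rightarrow> nat \<Rightarrow> nat" where
  "turan_number n m = card (turan_graph n m)"

lemma finite_pair_counts: "finite (pair_counts n k d)"
proof -
  have "card (intersecting_pairs F) \<le> card (Pow {..<n})" if "length F = n"
    for F :: "(nat \<Rightarrow> real) set list"
    by (rule card_mono) (auto simp: intersecting_pairs_def that)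
  then have "pair_counts n k d \<subseteq> {..card (Pow {..<n})}"
    unfolding pair_counts_def box_family_def by blast
  then show ?thesis
    by (rule finite_subset) simp
qed

lemma pair_counts_nonempty:
  assumes "1 \<le> k" "1 \<le> d"
  shows "pair_counts n k d \<noteq> {}"
proof -
  define P :: "nat \<Rightarrow> (nat \<Rightarrow> real) set" where "P j = (\<Pi>\<^sub>E i\<in>{..<d}. {real j..real j})" for j
  define F where "F = map P [0..<n]"
  have disj: "i = j" if "x \<in> P i" "x \<in> P j" for x i j
  proof -
    have "x 0 \<in> {real l..real l}" if "x \<in> P l" for l
      using PiE_mem[OF that[unfolded P_def], of 0] assms by simp
    then have "x 0 = real i" "x 0 = real j"
      using that by (metis atLeastAtMost_singleton singletonD)+
    then show ?thesis by simp
  qed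
  have "is_box d (P j)" for j
    unfolding is_box_def P_def by (intro exI[of _ "\<lambda>_. real j"]) auto
  then have "box_family n d F"
    by (auto simp: box_family_def F_def)
  moreover have "no_common_point (k + 1) F"
    unfolding no_common_point_def
  proof (intro allI impI)
    fix I assume I: "I \<subseteq> {..<length F} \<and> card I = k + 1"
    show "(\<Inter>i\<in>I. F ! i) = {}"
    proof (rule ccontr)
      assume "(\<Inter>i\<in>I. F ! i) \<noteq> {}"
      then obtain x where x: "\<And>i. i \<in> I \<Longrightarrow> x \<in> F ! i" by auto
      have "x \<in> P i" if "i \<in> I" for i
        using x[OF that] I that by (auto simp: F_def)
      then have "\<forall>i\<in>I. \<forall>j\<in>I. i = j" using disj by blast
      then have "card I \<le> 1"
        using card_le_Suc0_iff_eq[of I] by (cases "finite I") auto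
      then show False using I assms by simp
    qed
  qed
  ultimately show ?thesis unfolding pair_counts_def by blast
qed

lemma turan_classes_balanced:
  fixes m n r s :: nat
  assumes "r < m" "s < m"
  shows "card {v\<in>{..<n}. v mod m = r} \<le> card {v\<in>{..<n}. v mod m = s} + 1"
proof -
  let ?A = "{v\<in>{..<n}. v mod m = r}"
  have *: "v = r + m * (v div m)" if "v \<in> ?A" for v
    using that mod_mult_div_eq[of v m] by simp
  have div_nz: "v div m \<noteq> 0" if "v \<in> ?A - {r}" for v
  proof
    assume "v div m = 0"
    moreover have "v = r + m * (v div m)" "v \<noteq> r" using *[of v] that by blast+
    ultimately show False by simp
  qed
  define g where "g v = s + m * (v div m - 1)" for v
  have "inj_on g (?A - {r})"
  proof (rule inj_onI)
    fix u v assume uv: "u \<in> ?A - {r}" "v \<in> ?A - {r}" "g u = g v"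
    have "u div m \<noteq> 0" "v div m \<noteq> 0" using uv(1,2) by (simp_all only: div_nz not_False_eq_True)
    moreover have "u div m - 1 = v div m - 1" using uv(3) assms by (simp add: g_def)
    ultimately have "u div m = v div m" by linarith
    moreover have "u = r + m * (u div m)" "v = r + m * (v div m)" using uv * by blast+
    ultimately show "u = v" by metis
  qed
  moreover have "g ` (?A - {r}) \<subseteq> {v\<in>{..<n}. v mod m = s}"
  proof
    fix w assume "w \<in> g ` (?A - {r})"
    then obtain v where v: "v \<in> ?A - {r}" "w = g v" by blast
    then have nz: "v div m \<noteq> 0" using div_nz by blast
    then have "w < m + m * (v div m - 1)" using v assms by (simp add: g_def)
    also have "\<dots> = m * (v div m)" using nz by (cases "v div m") auto
    also have "\<dots> \<le> v" by simp
    finally have "w < n" using v by auto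
    then show "w \<in> {v\<in>{..<n}. v mod m = s}" using v assms by (simp add: g_def)
  qed
  ultimately have "card (?A - {r}) \<le> card {v\<in>{..<n}. v mod m = s}"
    by (intro card_inj_on_le) auto
  moreover have "card ?A \<le> card (?A - {r}) + 1"
    using diff_card_le_card_Diff[of "{r}" ?A] by simp
  ultimately show ?thesis by linarith
qed

end

theory Submission
  imports Defs
begin

text \<open>
  Put \<open>m = min k d\<close> and \<open>s = k - m\<close>. The extremal family consists of \<open>s\<close> copies of a big cube and
  \<open>n - s\<close> slabs of it, distributed evenly over \<open>m\<close> directions. For the upper bound it suffices to
  find, in a family of \<open>n > s\<close> boxes, one that misses at least \<open>(n - s - 1) div m\<close> others, and to
  delete it. If \<open>d \<le> k\<close>, take in every coordinate direction the box whose right endpoint is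
  least: a box meeting all these \<open>d\<close> boxes contains the point whose coordinates are these endpoints,
  so there are at most \<open>k\<close> such boxes, and the remaining at least \<open>n - k\<close> boxes are each missed by
  one of the \<open>d\<close> chosen ones. If \<open>k \<le> d\<close>, a maximal set of pairwise intersecting boxes, which by
  Helly's theorem for boxes has at most \<open>k\<close> members, plays the same role.
\<close>

section \<open>Counting edges\<close>

text \<open>\<open>E\<close> relates arbitrary vertices, so adding or deleting a vertex changes only
  \<open>V\<close>. Loops have to be cut off because every box meets itself.\<close>

definition edge_set :: "'v set \<Rightarrow> ('v \<Rightarrow> 'v \<Rightarrow> bool) \<Rightarrow> 'v set set" where
  "edge_set V E = {{u, v} | u v. u \<in> V \<and> v \<in> V \<and> u \<noteq> v \<and> E u v}"

lemma edge_set_cong: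
  assumes "\<And>u v. u \<in> V \<Longrightarrow> v \<in> V \<Longrightarrow> u \<noteq> v \<Longrightarrow> E u v \<longleftrightarrow> E' u v"
  shows "edge_set V E = edge_set V E'"
  unfolding edge_set_def by (intro Collect_cong ex_cong1 conj_cong refl assms)

lemma finite_edge_set: "finite V \<Longrightarrow> finite (edge_set V E)"
  by (rule finite_subset[of _ "Pow V"]) (auto simp: edge_set_def)

lemma card_edge_set_insert:
  assumes "finite V" "x \<notin> V" "symp E"
  shows "card (edge_set (insert x V) E) = card (edge_set V E) + card {v \<in> V. E x v}"
proof -
  have "edge_set (insert x V) E = edge_set V E \<union> (\<lambda>v. {x, v}) ` {v \<in> V. E x v}"
  proof (intro equalityI subsetI)
    fix e assume "e \<in> edge_set (insert x V) E"
    then obtain u v where uv: "e = {u, v}" "u \<in> insert x V" "v \<in> insert x V" "u \<noteq> v" "E u v"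
      by (auto simp: edge_set_def)
    moreover have "E v u" using uv(5) assms(3) by (meson sympD)
    ultimately show "e \<in> edge_set V E \<union> (\<lambda>v. {x, v}) ` {v \<in> V. E x v}"
      by (auto simp: edge_set_def insert_commute)
  next
    fix e assume "e \<in> edge_set V E \<union> (\<lambda>v. {x, v}) ` {v \<in> V. E x v}"
    then show "e \<in> edge_set (insert x V) E"
      using assms(2) unfolding edge_set_def by blast
  qed
  moreover have "edge_set V E \<inter> (\<lambda>v. {x, v}) ` {v \<in> V. E x v} = {}"
    using assms(2) by (auto simp: edge_set_def doubleton_eq_iff)
  moreover have "inj_on (\<lambda>v. {x, v}) {v \<in> V. E x v}"
    by (auto simp: inj_on_def doubleton_eq_iff)
  ultimately show ?thesis
    using assms(1) by (simp add: card_Un_disjoint finite_edge_set card_image)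
qed

lemma card_edge_set_le_choose_two:
  assumes "finite V"
  shows "card (edge_set V E) \<le> card V choose 2"
proof -
  have "edge_set V E \<subseteq> {K. K \<subseteq> V \<and> card K = 2}"
    by (auto simp: edge_set_def)
  then have "card (edge_set V E) \<le> card {K. K \<subseteq> V \<and> card K = 2}"
    using assms by (intro card_mono) auto
  then show ?thesis
    using assms by (simp add: n_subsets)
qed

section \<open>Growth of the Turan number by one vertex\<close>

lemma turan_graph_eq_edge_set: "turan_graph n m = edge_set {..<n} (\<lambda>u v. u mod m \<noteq> v mod m)"
  unfolding turan_graph_def complete_multipartite_def edge_set_def
  by (intro Collect_cong ex_cong1 conj_cong) auto

text \<open>The class consists of the \<open>q * m + n mod m\<close> with
  \<open>q < n div m\<close>; the next such number is \<open>n\<close> itself. These are the old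
  vertices not adjacent to \<open>n\<close> when \<open>n\<close> joins the Turan graph.\<close>

lemma card_residue_class_of_bound:
  assumes "0 < m"
  shows "card {v \<in> {..<n}. v mod m = n mod m} = n div m"
proof -
  have "{v \<in> {..<n}. v mod m = n mod m} = (\<lambda>q. q * m + n mod m) ` {..<n div m}"
  proof (intro equalityI subsetI)
    fix v assume v: "v \<in> {v \<in> {..<n}. v mod m = n mod m}"
    have dm: "v div m * m + v mod m = v" "n div m * m + n mod m = n" by simp_all
    have "v < n" "v mod m = n mod m" using v by auto
    then have "v div m * m < n div m * m" using dm by linarith
    then have "v div m < n div m" by simp
    moreover have "v = v div m * m + n mod m" using v dm by simp
    ultimately show "v \<in> (\<lambda>q. q * m + n mod m) ` {..<n div m}" by blast
  next
    fix v assume "v \<in> (\<lambda>q. q * m + n mod m) ` {..<n div m}"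
    then obtain q where q: "q < n div m" "v = q * m + n mod m" by auto
    have "q * m < n div m * m" using q assms by simp
    then have "q * m + n mod m < n div m * m + n mod m" by (rule add_strict_right_mono)
    then have "v < n" using q(2) by simp
    then show "v \<in> {v \<in> {..<n}. v mod m = n mod m}" using q by simp
  qed
  moreover have "inj_on (\<lambda>q. q * m + n mod m) {..<n div m}"
    using assms by (auto simp: inj_on_def)
  ultimately show ?thesis by (simp add: card_image)
qed

lemma turan_number_Suc:
  assumes "0 < m"
  shows "turan_number (Suc n) m = turan_number n m + (n - n div m)"
proof -
  have "card {v \<in> {..<n}. n mod m \<noteq> v mod m} = card ({..<n} - {v \<in> {..<n}. v mod m = n mod m})"
    by (rule arg_cong[of _ _ card]) auto
  also have "\<dots> = n - n div m"
    using card_residue_class_of_bound[OF assms, of n] by (subst card_Diff_subset) auto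
  finally show ?thesis
    unfolding turan_number_def turan_graph_eq_edge_set lessThan_Suc
    by (subst card_edge_set_insert) (auto simp: symp_def)
qed

lemma turan_number_one: "turan_number n 1 = 0"
  by (simp add: turan_number_def turan_graph_def complete_multipartite_def)

section \<open>Upper bound by vertex deletion\<close>

text \<open>For \<open>m > 0\<close>, the number of edges of the join of the Turan graph on
  \<open>N\<close> vertices in \<open>m\<close> classes with a complete graph on \<open>s\<close>
  vertices. It is the value of both the upper bound and the construction.\<close>

definition join_number :: "nat \<Rightarrow> nat \<Rightarrow> nat \<Rightarrow> nat" where
  "join_number N m s = turan_number N m + s * N + (s choose 2)"

text \<open>Pigeonhole: a vertex outside the common neighbourhood is missed by some \<open>u\<close>
  in \<open>S\<close>. With \<open>q\<close> the claimed bound, fewer than \<open>q\<close> misses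
  for each \<open>u\<close> would give \<open>card W\<close> \<le>
  \<open>m + s + m * (q - 1) = s + m * q\<close>, which is less than \<open>card W\<close>.\<close>

lemma exists_vertex_with_many_non_neighbours:
  assumes "finite W" "S \<subseteq> W" "S \<noteq> {}" "card S \<le> m" "0 < m" "s < card W"
    and common: "card {v \<in> W. \<forall>u\<in>S. v = u \<or> E u v} \<le> m + s"
  shows "\<exists>u\<in>S. (card W - s - 1) div m \<le> card {v \<in> W. v \<noteq> u \<and> \<not> E u v}"
proof (rule ccontr)
  define q where "q = (card W - s - 1) div m"
  let ?N = "\<lambda>u. {v \<in> W. v \<noteq> u \<and> \<not> E u v}"
  assume "\<not> ?thesis"
  then have less: "card (?N u) < q" if "u \<in> S" for u
    using that by (auto simp: q_def not_le)
  \<comment> \<open>Truncated subtraction: only for positive \<open>q\<close> does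
    \<open>m + m * (q - 1)\<close> equal \<open>m * q\<close>.\<close>
  have q: "0 < q" using less assms(3) by fastforce
  have "finite S" using assms finite_subset by blast
  then have "card (\<Union>u\<in>S. ?N u) \<le> (\<Sum>u\<in>S. card (?N u))"
    by (rule card_UN_le)
  also have "\<dots> \<le> card S * (q - 1)"
    using less sum_bounded_above[of S "\<lambda>u. card (?N u)" "q - 1"] by fastforce
  also have "\<dots> \<le> m * (q - 1)" using assms(4) by simp
  finally have U: "card (\<Union>u\<in>S. ?N u) \<le> m * (q - 1)" .
  have "W = {v \<in> W. \<forall>u\<in>S. v = u \<or> E u v} \<union> (\<Union>u\<in>S. ?N u)" by blast
  then have "card W \<le> card {v \<in> W. \<forall>u\<in>S. v = u \<or> E u v} + card (\<Union>u\<in>S. ?N u)"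
    by (metis (lifting) card_Un_le)
  also have "\<dots> \<le> m + s + m * (q - 1)" using common U by simp
  also have "\<dots> = s + m * q" using q by (cases q) auto
  also have "\<dots> \<le> s + (card W - s - 1)" by (simp add: q_def)
  finally show False using assms(6) by simp
qed

text \<open>Deleting a vertex with many non-neighbours loses at most \<open>N + s - N div m\<close>
  edges, exactly the growth of \<open>join_number\<close> from \<open>N\<close> to
  \<open>Suc N\<close>. The hypothesis ranges over all nonempty subsets so that it survives the
  deletion.\<close>

lemma card_edge_set_le_join_number:
  assumes "symp E" "finite W" "0 < m" "s \<le> card W"
    and hered: "\<And>W'. W' \<subseteq> W \<Longrightarrow> W' \<noteq> {} \<Longrightarrow>
      \<exists>S\<subseteq>W'. S \<noteq> {} \<and> card S \<le> m \<and> card {v \<in> W'. \<forall>u\<in>S. v = u \<or> E u v} \<le> m + s"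
  shows "card (edge_set W E) \<le> join_number (card W - s) m s"
  using assms(2,4,5)
proof (induction "card W - s" arbitrary: W)
  case 0
  then have "card W = s" by simp
  then show ?case
    using card_edge_set_le_choose_two[OF 0(2), of E] by (simp add: join_number_def)
next
  case (Suc N)
  then have W: "card W = Suc (N + s)" by simp
  then have "W \<noteq> {}" by auto
  then obtain S where S: "S \<subseteq> W" "S \<noteq> {}" "card S \<le> m"
      "card {v \<in> W. \<forall>u\<in>S. v = u \<or> E u v} \<le> m + s"
    using Suc.prems(3)[of W] by blast
  \<comment> \<open>Here \<open>card W - s - 1\<close> is \<open>N\<close>, so the pigeonhole bound
    reads \<open>N div m\<close>.\<close>
  then obtain u where u: "u \<in> S" "N div m \<le> card {v \<in> W. v \<noteq> u \<and> \<not> E u v}"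
    using exists_vertex_with_many_non_neighbours[of W S m s E] Suc.prems(1) assms(3) W by auto
  define W' where "W' = W - {u}"
  have uW: "u \<in> W" using u S by blast
  have W': "card W' = N + s" "finite W'" "u \<notin> W'" "W = insert u W'"
    using uW W Suc.prems(1) by (auto simp: W'_def)
  have IH: "card (edge_set W' E) \<le> join_number (card W' - s) m s"
    by (rule Suc.hyps(1)) (use W'(1,2) Suc.prems(3) in \<open>auto simp: W'_def\<close>)
  have "{v \<in> W'. E u v} = W' - {v \<in> W. v \<noteq> u \<and> \<not> E u v}"
    by (auto simp: W'_def)
  also have "card \<dots> = N + s - card {v \<in> W. v \<noteq> u \<and> \<not> E u v}"
    unfolding W'(1)[symmetric] by (rule card_Diff_subset) (use Suc.prems(1) in \<open>auto simp: W'_def\<close>)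
  finally have deg: "card {v \<in> W'. E u v} \<le> N + s - N div m"
    using u by simp
  have "card (edge_set W E) = card (edge_set W' E) + card {v \<in> W'. E u v}"
    unfolding W'(4) using W'(2,3) assms(1) by (rule card_edge_set_insert)
  also have "\<dots> \<le> join_number N m s + (N + s - N div m)"
    using IH deg W'(1) by simp
  also have "\<dots> = join_number (Suc N) m s"
    using turan_number_Suc[OF assms(3), of N] div_le_dividend[of N m]
    unfolding join_number_def mult_Suc_right by linarith
  finally show ?case using W by simp
qed

section \<open>Boxes\<close>

lemma intersecting_pairs_eq_edge_set:
  "intersecting_pairs F = edge_set {..<length F} (\<lambda>i j. F ! i \<inter> F ! j \<noteq> {})"
  unfolding intersecting_pairs_def edge_set_def by (intro Collect_cong ex_cong1) auto

text \<open>\<open>no_common_point\<close> speaks of exactly \<open>k + 1\<close> members; a larger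
  set of members contains such a subset.\<close>

lemma card_le_of_common_point:
  assumes "no_common_point (k + 1) F" "J \<subseteq> {..<length F}" "\<And>i. i \<in> J \<Longrightarrow> p \<in> F ! i"
  shows "card J \<le> k"
proof (rule ccontr)
  assume "\<not> ?thesis"
  then obtain I where I: "I \<subseteq> J" "card I = k + 1"
    using obtain_subset_with_card_n[of "k + 1" J] by auto
  then have "(\<Inter>i\<in>I. F ! i) = {}"
    using assms(1,2) unfolding no_common_point_def by blast
  then show False using assms(3) I by blast
qed

lemma box_familyE:
  assumes "box_family n d F"
  obtains a b where "\<And>i c. i < n \<Longrightarrow> c < d \<Longrightarrow> a i c \<le> b i c"
    and "\<And>i. i < n \<Longrightarrow> F ! i = (\<Pi>\<^sub>E c\<in>{..<d}. {a i c..b i c})"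
proof -
  have "\<exists>a b. (\<forall>c<d. a c \<le> b c) \<and> F ! i = (\<Pi>\<^sub>E c\<in>{..<d}. {a c..b c})" if "i < n" for i
    using assms that unfolding box_family_def is_box_def by simp
  then obtain a b where "\<forall>i<n. (\<forall>c<d. a i c \<le> b i c) \<and> F ! i = (\<Pi>\<^sub>E c\<in>{..<d}. {a i c..b i c})"
    by metis
  then show thesis
    by (intro that[of a b]) auto
qed

lemma PiE_intervals_meet_le:
  fixes a b a' b' :: "nat \<Rightarrow> real"
  assumes "(\<Pi>\<^sub>E c\<in>{..<d}. {a c..b c}) \<inter> (\<Pi>\<^sub>E c\<in>{..<d}. {a' c..b' c}) \<noteq> {}" "c < d"
  shows "a c \<le> b' c"
proof -
  obtain x where "x \<in> (\<Pi>\<^sub>E c\<in>{..<d}. {a c..b c})" "x \<in> (\<Pi>\<^sub>E c\<in>{..<d}. {a' c..b' c})"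
    using assms(1) by blast
  then have "x c \<in> {a c..b c}" "x c \<in> {a' c..b' c}"
    using assms(2) by (simp_all add: PiE_iff)
  then show ?thesis by simp
qed

lemma extreme_boxes_few_common_neighbours:
  assumes F: "box_family n d F" "no_common_point (k + 1) F" and "1 \<le> d"
    and W: "W \<subseteq> {..<n}" "W \<noteq> {}"
  shows "\<exists>S\<subseteq>W. S \<noteq> {} \<and> card S \<le> d \<and>
    card {v \<in> W. \<forall>u\<in>S. v = u \<or> F ! u \<inter> F ! v \<noteq> {}} \<le> k"
proof -
  have len: "length F = n" using F by (simp add: box_family_def)
  obtain a b where ab: "\<And>i c. i < n \<Longrightarrow> c < d \<Longrightarrow> a i c \<le> b i c"
      "\<And>i. i < n \<Longrightarrow> F ! i = (\<Pi>\<^sub>E c\<in>{..<d}. {a i c..b i c})"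
    using box_familyE[OF F(1)] by blast
  have "finite W" using W finite_subset by blast
  define B where "B c = arg_min_on (\<lambda>i. b i c) W" for c
  have B: "B c \<in> W" "\<And>v. v \<in> W \<Longrightarrow> b (B c) c \<le> b v c" for c
    unfolding B_def using \<open>finite W\<close> W(2) by (auto intro: arg_min_if_finite arg_min_least)
  define p where "p = (\<lambda>c\<in>{..<d}. b (B c) c)"
  let ?J = "{v \<in> W. \<forall>u\<in>B ` {..<d}. v = u \<or> F ! u \<inter> F ! v \<noteq> {}}"
  have "p \<in> F ! v" if v: "v \<in> ?J" for v
  proof -
    have vn: "v < n" using v W by auto
    have "b (B c) c \<in> {a v c..b v c}" if c: "c < d" for c
    proof -
      \<comment> \<open>If \<open>v\<close> is \<open>B c\<close> itself, its interval being
        nonempty replaces the intersection.\<close>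
      have "v = B c \<or> F ! v \<inter> F ! B c \<noteq> {}" using v c by auto
      moreover have Bn: "B c < n" using B(1) W by auto
      ultimately have "a v c \<le> b (B c) c"
        using PiE_intervals_meet_le[of d "a v" "b v" "a (B c)" "b (B c)" c] ab vn c by auto
      then show ?thesis using B(2)[of v c] v by simp
    qed
    then show ?thesis using ab(2)[OF vn] by (auto simp: p_def)
  qed
  then have "card ?J \<le> k"
    using W len by (intro card_le_of_common_point[OF F(2), where p = p]) auto
  moreover have "card (B ` {..<d}) \<le> d"
    using card_image_le[of "{..<d}" B] by simp
  moreover have "B ` {..<d} \<subseteq> W" "B ` {..<d} \<noteq> {}"
    using B(1) assms(3) by (auto simp: lessThan_empty_iff)
  ultimately show ?thesis by blast
qed

text \<open>In each direction every left end is at most every right end, so the largest left end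
  lies in all the intervals.\<close>

lemma Helly_boxes:
  assumes F: "box_family n d F"
    and S: "S \<subseteq> {..<n}" "\<And>i j. i \<in> S \<Longrightarrow> j \<in> S \<Longrightarrow> F ! i \<inter> F ! j \<noteq> {}"
  shows "\<exists>p. \<forall>i\<in>S. p \<in> F ! i"
proof (cases "S = {}")
  case False
  obtain a b where ab: "\<And>i c. i < n \<Longrightarrow> c < d \<Longrightarrow> a i c \<le> b i c"
      "\<And>i. i < n \<Longrightarrow> F ! i = (\<Pi>\<^sub>E c\<in>{..<d}. {a i c..b i c})"
    using box_familyE[OF F] by blast
  have "finite S" using S(1) finite_subset by blast
  \<comment> \<open>The restriction to \<open>{..<d}\<close> makes \<open>p\<close> extensional, as
    membership in a box demands.\<close>
  define p where "p = (\<lambda>c\<in>{..<d}. Max ((\<lambda>i. a i c) ` S))"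
  have "Max ((\<lambda>i. a i c) ` S) \<in> {a j c..b j c}" if "j \<in> S" "c < d" for j c
  proof -
    have "a i c \<le> b j c" if "i \<in> S" for i
      using PiE_intervals_meet_le[of d "a i" "b i" "a j" "b j" c] S(2)[of i j] ab(2) S(1)
        that \<open>j \<in> S\<close> \<open>c < d\<close> by auto
    then show ?thesis using \<open>finite S\<close> False that by auto
  qed
  then have "p \<in> F ! j" if "j \<in> S" for j
    using ab(2)[of j] that S(1) by (auto simp: p_def)
  then show ?thesis by blast
qed simp

text \<open>By maximality a box meeting all members of the clique \<open>S\<close> already belongs
  to \<open>S\<close>, so the common neighbours lie in \<open>S\<close>.\<close>

lemma maximal_clique_few_common_neighbours:
  assumes F: "box_family n d F" "no_common_point (k + 1) F"
    and W: "W \<subseteq> {..<n}" "W \<noteq> {}"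
  shows "\<exists>S\<subseteq>W. S \<noteq> {} \<and> card S \<le> k \<and>
    card {v \<in> W. \<forall>u\<in>S. v = u \<or> F ! u \<inter> F ! v \<noteq> {}} \<le> k"
proof -
  have len: "length F = n" using F by (simp add: box_family_def)
  have "finite W" using W finite_subset by blast
  define C where "C = {S. S \<subseteq> W \<and> (\<forall>i\<in>S. \<forall>j\<in>S. F ! i \<inter> F ! j \<noteq> {})}"
  have ne: "F ! i \<noteq> {}" if "i < n" for i
  proof -
    obtain a b where "\<And>i c. i < n \<Longrightarrow> c < d \<Longrightarrow> a i c \<le> b i c"
        "\<And>i. i < n \<Longrightarrow> F ! i = (\<Pi>\<^sub>E c\<in>{..<d}. {a i c..b i c})"
      using box_familyE[OF F(1)] by blast
    then show ?thesis using that by (simp add: PiE_eq_empty_iff)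
  qed
  obtain w where w: "w \<in> W" using W by blast
  have "finite C" using \<open>finite W\<close> by (simp add: C_def)
  moreover have "{w} \<in> C" using w ne W by (auto simp: C_def)
  ultimately obtain S where S: "S \<in> C" "{w} \<subseteq> S" and max: "\<And>T. T \<in> C \<Longrightarrow> S \<subseteq> T \<Longrightarrow> S = T"
    using finite_has_maximal2[of C "{w}"] by blast
  have "S \<subseteq> {..<n}" using S W by (auto simp: C_def)
  moreover obtain p where "\<forall>i\<in>S. p \<in> F ! i"
    using Helly_boxes[OF F(1) \<open>S \<subseteq> {..<n}\<close>] S by (auto simp: C_def)
  ultimately have "card S \<le> k"
    using len by (intro card_le_of_common_point[OF F(2), where p = p]) auto
  moreover have "{v \<in> W. \<forall>u\<in>S. v = u \<or> F ! u \<inter> F ! v \<noteq> {}} \<subseteq> S"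
  proof
    fix v assume v: "v \<in> {v \<in> W. \<forall>u\<in>S. v = u \<or> F ! u \<inter> F ! v \<noteq> {}}"
    \<comment> \<open>The clique condition in \<open>C\<close> includes equal indices, so
      \<open>v\<close> must also meet itself.\<close>
    have "F ! v \<noteq> {}" using v W ne by auto
    then have "F ! u \<inter> F ! v \<noteq> {} \<and> F ! v \<inter> F ! u \<noteq> {}" if "u \<in> S" for u
      using v that by auto
    then have "insert v S \<in> C"
      using S(1) v \<open>F ! v \<noteq> {}\<close> by (simp add: C_def)
    then show "v \<in> S" using max[of "insert v S"] by blast
  qed
  moreover have "finite S" using S(1) \<open>finite W\<close> finite_subset by (auto simp: C_def)
  ultimately show ?thesis
    using S card_mono[of S] by (intro exI[of _ S]) (auto simp: C_def intro: order_trans)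
qed

lemma card_intersecting_pairs_le:
  assumes F: "box_family n d F" "no_common_point (k + 1) F" and "1 \<le> k" "1 \<le> d" "k \<le> n"
  shows "card (intersecting_pairs F) \<le>
    join_number (n - (k - min k d)) (min k d) (k - min k d)"
proof -
  let ?E = "\<lambda>i j. F ! i \<inter> F ! j \<noteq> {}"
  have len: "length F = n" using F by (simp add: box_family_def)
  have "\<exists>S\<subseteq>W. S \<noteq> {} \<and> card S \<le> min k d \<and>
      card {v \<in> W. \<forall>u\<in>S. v = u \<or> ?E u v} \<le> min k d + (k - min k d)"
    if "W \<subseteq> {..<n}" "W \<noteq> {}" for W
    \<comment> \<open>Both lemmas bound the common neighbours by \<open>k\<close>, which is
      \<open>min k d + (k - min k d)\<close>; they differ in the bound on \<open>S\<close>.\<close>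
    using maximal_clique_few_common_neighbours[OF F that]
      extreme_boxes_few_common_neighbours[OF F assms(4) that]
    by (cases "k \<le> d") (simp_all add: min_def)
  then have "card (edge_set {..<n} ?E) \<le>
      join_number (card {..<n} - (k - min k d)) (min k d) (k - min k d)"
    by (intro card_edge_set_le_join_number) (use assms in \<open>auto simp: symp_def\<close>)
  then show ?thesis by (simp add: intersecting_pairs_eq_edge_set len)
qed

section \<open>The extremal family\<close>

text \<open>For \<open>i < N\<close> the slab is pinned to the height \<open>i\<close> in direction
  \<open>i mod m\<close> and is \<open>[0, N]\<close> in the others; distinct heights keep parallel
  slabs disjoint. Indices from \<open>N\<close> on give the full cube.\<close>

definition slab_lower :: "nat \<Rightarrow> nat \<Rightarrow> nat \<Rightarrow> nat \<Rightarrow> real" where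
  "slab_lower N m i c = (if i < N \<and> c = i mod m then real i else 0)"

definition slab_upper :: "nat \<Rightarrow> nat \<Rightarrow> nat \<Rightarrow> nat \<Rightarrow> real" where
  "slab_upper N m i c = (if i < N \<and> c = i mod m then real i else real N)"

definition slab :: "nat \<Rightarrow> nat \<Rightarrow> nat \<Rightarrow> nat \<Rightarrow> (nat \<Rightarrow> real) set" where
  "slab d N m i = (\<Pi>\<^sub>E c\<in>{..<d}. {slab_lower N m i c..slab_upper N m i c})"

lemma is_box_slab: "is_box d (slab d N m i)"
  unfolding is_box_def slab_def
  by (rule exI[of _ "slab_lower N m i"], rule exI[of _ "slab_upper N m i"])
    (simp add: slab_lower_def slab_upper_def)

lemma slab_coordinate:
  assumes "x \<in> slab d N m i" "i < N" "0 < m" "m \<le> d"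
  shows "x (i mod m) = real i"
proof -
  have "i mod m < d" using assms(3,4) by (meson mod_less_divisor order_less_le_trans)
  then have "x (i mod m) \<in> {slab_lower N m i (i mod m)..slab_upper N m i (i mod m)}"
    using assms(1) by (simp add: slab_def PiE_iff)
  then show ?thesis using assms(2) by (simp add: slab_lower_def slab_upper_def)
qed

lemma slab_meet_iff:
  assumes "0 < m" "m \<le> d" "i \<noteq> j"
  shows "slab d N m i \<inter> slab d N m j \<noteq> {} \<longleftrightarrow> N \<le> i \<or> N \<le> j \<or> i mod m \<noteq> j mod m"
proof
  assume "slab d N m i \<inter> slab d N m j \<noteq> {}"
  then obtain x where x: "x \<in> slab d N m i" "x \<in> slab d N m j" by blast
  show "N \<le> i \<or> N \<le> j \<or> i mod m \<noteq> j mod m"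
    using slab_coordinate[OF x(1)] slab_coordinate[OF x(2)] assms
    by (metis not_le of_nat_eq_iff)
next
  assume *: "N \<le> i \<or> N \<le> j \<or> i mod m \<noteq> j mod m"
  \<comment> \<open>No coordinate is pinned by both boxes, so the larger lower end is the pinned
    value if there is one and 0 otherwise; it lies in both intervals.\<close>
  define x where "x = (\<lambda>c\<in>{..<d}. max (slab_lower N m i c) (slab_lower N m j c))"
  have "x \<in> slab d N m i \<inter> slab d N m j"
    using * by (auto simp: x_def slab_def slab_lower_def slab_upper_def)
  then show "slab d N m i \<inter> slab d N m j \<noteq> {}" by blast
qed

text \<open>A point lies in at most one slab of each of the \<open>m\<close> directions, since its
  coordinate there determines the index; the cubes add at most \<open>s\<close> more.\<close>

lemma no_common_point_slabs:
  assumes "0 < m" "m \<le> d" "k = m + s"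
  shows "no_common_point (k + 1) (map (slab d N m) [0..<N + s])"
  unfolding no_common_point_def
proof (intro allI impI, rule ccontr)
  fix I
  assume "I \<subseteq> {..<length (map (slab d N m) [0..<N + s])} \<and> card I = k + 1"
  then have I: "I \<subseteq> {..<N + s}" "card I = k + 1" by auto
  assume "(\<Inter>i\<in>I. map (slab d N m) [0..<N + s] ! i) \<noteq> {}"
  then obtain x where x: "\<And>i. i \<in> I \<Longrightarrow> x \<in> map (slab d N m) [0..<N + s] ! i" by auto
  have x': "x \<in> slab d N m i" if "i \<in> I" for i
    using x[OF that] I(1) that by (auto simp del: upt_Suc)
  have "inj_on (\<lambda>i. i mod m) (I \<inter> {..<N})"
  proof (rule inj_onI)
    fix i j assume ij: "i \<in> I \<inter> {..<N}" "j \<in> I \<inter> {..<N}" "i mod m = j mod m"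
    have "x (i mod m) = real i" "x (j mod m) = real j"
      using slab_coordinate[OF x' _ assms(1,2)] ij(1,2) by auto
    then show "i = j" using ij(3) by (metis of_nat_eq_iff)
  qed
  moreover have "(\<lambda>i. i mod m) ` (I \<inter> {..<N}) \<subseteq> {..<m}" using assms(1) by auto
  ultimately have "card (I \<inter> {..<N}) \<le> m"
    using card_inj_on_le[of "\<lambda>i. i mod m" _ "{..<m}"] by simp
  moreover have "card {N..<N + s} = s" by simp
  moreover have "card I \<le> card ((I \<inter> {..<N}) \<union> {N..<N + s})"
    using I(1) by (intro card_mono) auto
  moreover have "card ((I \<inter> {..<N}) \<union> {N..<N + s}) \<le> card (I \<inter> {..<N}) + card {N..<N + s}"
    by (rule card_Un_le)
  ultimately show False using I(2) assms(3) by simp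
qed

text \<open>The cubes are added one at a time, each adjacent to all \<open>N + s\<close> earlier
  vertices.\<close>

lemma card_edge_set_turan_join:
  "card (edge_set {..<N + s} (\<lambda>i j. N \<le> i \<or> N \<le> j \<or> i mod m \<noteq> j mod m)) = join_number N m s"
proof (induction s)
  case 0
  have "edge_set {..<N} (\<lambda>i j. N \<le> i \<or> N \<le> j \<or> i mod m \<noteq> j mod m) = turan_graph N m"
    unfolding turan_graph_eq_edge_set by (rule edge_set_cong) auto
  then show ?case by (simp add: join_number_def turan_number_def)
next
  case (Suc s)
  let ?E = "\<lambda>i j. N \<le> i \<or> N \<le> j \<or> i mod m \<noteq> j mod m"
  have "card (edge_set (insert (N + s) {..<N + s}) ?E) =
      card (edge_set {..<N + s} ?E) + card {v \<in> {..<N + s}. ?E (N + s) v}"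
    by (rule card_edge_set_insert) (auto simp: symp_def)
  moreover have "{v \<in> {..<N + s}. ?E (N + s) v} = {..<N + s}" by auto
  moreover have "{..<N + Suc s} = insert (N + s) {..<N + s}" by auto
  ultimately show ?case
    using Suc.IH by (simp add: join_number_def numeral_2_eq_2)
qed

lemma join_number_mem_pair_counts:
  assumes "0 < m" "m \<le> d" "k = m + s"
  shows "join_number N m s \<in> pair_counts (N + s) k d"
proof -
  let ?F = "map (slab d N m) [0..<N + s]"
  have "intersecting_pairs ?F =
      edge_set {..<N + s} (\<lambda>i j. N \<le> i \<or> N \<le> j \<or> i mod m \<noteq> j mod m)"
  proof -
    have *: "?F ! i \<inter> ?F ! j \<noteq> {} \<longleftrightarrow> N \<le> i \<or> N \<le> j \<or> i mod m \<noteq> j mod m"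
      if "i < N + s" "j < N + s" "i \<noteq> j" for i j
      using that slab_meet_iff[OF assms(1,2), of i j N] by (simp del: upt_Suc)
    have len: "length ?F = N + s" by simp
    show ?thesis
      unfolding intersecting_pairs_eq_edge_set len
      by (rule edge_set_cong) (rule *, auto)
  qed
  then have "card (intersecting_pairs ?F) = join_number N m s"
    by (simp add: card_edge_set_turan_join)
  moreover have "box_family (N + s) d ?F"
    by (auto simp: box_family_def is_box_slab)
  ultimately show ?thesis
    unfolding pair_counts_def mem_Collect_eq using no_common_point_slabs[OF assms]
    by (intro exI[of _ ?F]) (simp del: upt_Suc)
qed

section \<open>The exact maximum and the two formulas\<close>

lemma max_pairs_eq_join_number:
  assumes "1 \<le> k" "1 \<le> d" "k \<le> n"
  shows "max_pairs n k d = join_number (n - (k - min k d)) (min k d) (k - min k d)"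
  unfolding max_pairs_def
proof (rule Max_eqI[OF finite_pair_counts])
  fix y assume "y \<in> pair_counts n k d"
  then show "y \<le> join_number (n - (k - min k d)) (min k d) (k - min k d)"
    using card_intersecting_pairs_le assms by (auto simp: pair_counts_def)
next
  have "n - (k - min k d) + (k - min k d) = n" using assms by simp
  then show "join_number (n - (k - min k d)) (min k d) (k - min k d) \<in> pair_counts n k d"
    using join_number_mem_pair_counts[of "min k d" d k "k - min k d" "n - (k - min k d)"] assms
    by simp
qed

theorem mainTheorem1:
  "(\<forall>n k d :: nat. n \<ge> k \<and> k > d \<and> d \<ge> 1 \<longrightarrow>
      max_pairs n k d = turan_number (n - k + d) d + max_pairs n (k - d + 1) 1) \<and>
   (\<forall>n k d :: nat. n \<ge> k \<and> k \<ge> 1 \<and> d \<ge> 1 \<and> k \<le> d \<longrightarrow>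
      max_pairs n k d = turan_number n k)"
proof (intro conjI allI impI)
  fix n k d :: nat
  assume *: "n \<ge> k \<and> k > d \<and> d \<ge> 1"
  have "max_pairs n k d = join_number (n - (k - d)) d (k - d)"
    using max_pairs_eq_join_number[of k d n] * by (simp add: min_def)
  \<comment> \<open>In dimension 1 the excess \<open>(k - d + 1) - 1\<close> is again
    \<open>k - d\<close>. Hence the two joins differ only in their Turan terms, and the one with a
    single class is 0.\<close>
  moreover have "max_pairs n (k - d + 1) 1 = join_number (n - (k - d)) 1 (k - d)"
    using max_pairs_eq_join_number[of "k - d + 1" 1 n] * by (auto simp: min_def)
  moreover have "n - (k - d) = n - k + d" using * by simp
  ultimately show "max_pairs n k d = turan_number (n - k + d) d + max_pairs n (k - d + 1) 1"
    unfolding join_number_def turan_number_one by simp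
next
  fix n k d :: nat
  assume "n \<ge> k \<and> k \<ge> 1 \<and> d \<ge> 1 \<and> k \<le> d"
  then show "max_pairs n k d = turan_number n k"
    using max_pairs_eq_join_number[of k d n] by (simp add: min_def join_number_def)
qed

end
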